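(* Let $q>2$ be a prime power and let $G$ be a connected unicyclic graph on $s$ vertices $t_1,\dots,t_s$ whose unique induced cycle has even length $n=2k\geq 4$. Suppose, after relabeling, that the induced graph on $\{t_1,\dots,t_n\}$ is the cycle $C_n$ with edges $\{\{t_i,t_{i+1}\}: i=1,\dots,n-1\}\cup\{\{t_1,t_n\}\}$. Let $f\in KE(G)$ be a nonzero polynomial, written $f=f_n+f'$, where $$f_n=\alpha_{1,2}t_1t_2+\alpha_{2,3}t_2t_3+\dots+\alpha_{n-1,n}t_{n-1}t_n+\alpha_{1,n}t_1t_n,\qquad \alpha_{i,j}\in\mathbb{F}_q,$$ and $f'$ is a linear combination of the monomials of the edges of $G$ not in the cycle. Suppose that $f$ has exactly $r$ non-zero terms. (1) If at least one of the coefficients $\alpha_{i,j}$ of $f_n$ is zero, then $$|V_{(\mathbb{F}_q^* )^s}(f)|=\sum_{i=1}^{r-1}(-1)^{i+1}(q-1)^{s-i}.$$ (2) If all the coefficients $\alpha_{i,j}$ of $f_n$ are non-zero, then $$|V_{(\mathbb{F}_q^* )^s}(f)|=(-1)^{r-n}(q-1)^{s-r}\,|V_{(\mathbb{F}_q^* )^n}(f_n)|+\sum_{i=1}^{r-n}(-1)^{i+1}(q-1)^{s-i},$$ where, with $d_m=\left(\sum_{i=1}^{m-2}(-1)^{i+1}(q-1)^{m-i}\right)-(q-1)^{m-2}$, $$|V_{(\mathbb{F}_q^* )^n}(f_n)|=\begin{cases} q^{k-2}\left[(q-1)^3+(q-1)^2(q-2)\right]+\sum_{i=0}^{k-3}q^i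 d_{n-2i} & \text{if } \displaystyle\prod_{\substack{1\le i\le 2k-1\\ i\text{ odd}}}\alpha_{i,i+1}+(-1)^{k-1}\alpha_{1,n}\prod_{\substack{1\le i\le 2k-2\\ i\text{ even}}}\alpha_{i,i+1}=0,\\[2mm] q^{k-2}(q-1)^2(q-3)+\sum_{i=0}^{k-3}q^i d_{n-2i} & \text{otherwise.}\end{cases}$$
   Context: $K=\mathbb{F}_q$ is the finite field with $q$ elements and $\mathbb{F}_q^*=\mathbb{F}_q\setminus\{0\}$. Graphs are finite and simple. A cycle in a graph is induced if no edge joins two non-consecutive vertices of the cycle; a graph is unicyclic if it contains exactly one induced cycle. For a graph $G$ on vertex set $\{t_1,\dots,t_s\}$ with edge set $E$, the vertices are also regarded as variables and $KE(G)=\mathrm{span}_K\{t_it_j : \{t_i,t_j\}\in E\}\subseteq K[t_1,\dots,t_s]$. The number of non-zero terms of $f\in KE(G)$ is the number of edge monomials having non-zero coefficient in $f$. For a polynomial $f$ in $m$ variables, $V_{(\mathbb{F}_q^* )^m}(f)=\{P\in(\mathbb{F}_q^* )^m : f(P)=0\}$; here $f_n$ is regarded as a polynomial in the $n$ variables $t_1,\dots,t_n$. Empty sums are $0$. *)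

theory Defs
  imports Complex_Main "HOL-Library.Poly_Mapping" "HOL-Library.FuncSet"
begin

section \<open>Polynomials over a field in the variables \<open>t\<^sub>0, t\<^sub>1, \<dots>\<close>\<close>

text \<open>
  A monomial is a finitely supported map from variable indices to exponents, and a polynomial is a
  finitely supported map from monomials to coefficients; the product is the convolution product of
  \<^theory>\<open>HOL-Library.Poly_Mapping\<close>. The ring \<open>K[t\<^sub>1,\<dots>,t\<^sub>s]\<close> consists of those polynomials in which
  only the variables with index in \<open>{1..s}\<close> occur.
\<close>

type_synonym 'a mpoly = "(nat \<Rightarrow>\<^sub>0 nat) \<Rightarrow>\<^sub>0 'a"

definition Const :: "'a::zero \<Rightarrow> 'a mpoly" where
  "Const c = Poly_Mapping.single 0 c"

definition Var :: "nat \<Rightarrow> 'a::zero_neq_one mpoly" where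
  "Var i = Poly_Mapping.single (Poly_Mapping.single i 1) 1"

definition eval_mpoly :: "(nat \<Rightarrow> 'a::comm_semiring_1) \<Rightarrow> 'a mpoly \<Rightarrow> 'a" where
  "eval_mpoly P f =
     (\<Sum>m \<in> Poly_Mapping.keys f. Poly_Mapping.lookup f m *
        (\<Prod>i \<in> Poly_Mapping.keys m. P i ^ Poly_Mapping.lookup m i))"

definition mpoly_scale :: "'a::field \<Rightarrow> 'a mpoly \<Rightarrow> 'a mpoly" where
  "mpoly_scale c f = Const c * f"

global_interpretation mpoly: vector_space mpoly_scale
  by unfold_locales
    (simp_all add: mpoly_scale_def Const_def single_add mult_single algebra_simps
      flip: mult.assoc single_one)

text \<open>Points of \<open>(K\<^sup>*)\<^sup>m\<close> are functions on \<open>{1..m}\<close>, extended by \<^const>\<open>undefined\<close>.\<close>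

definition torus :: "nat \<Rightarrow> (nat \<Rightarrow> 'a::zero) set" where
  "torus m = {1..m} \<rightarrow>\<^sub>E (UNIV - {0})"

definition torus_zeros :: "nat \<Rightarrow> 'a::comm_semiring_1 mpoly \<Rightarrow> (nat \<Rightarrow> 'a) set" where
  "torus_zeros m f = {P \<in> torus m. eval_mpoly P f = 0}"


section \<open>Graphs\<close>

text \<open>A graph is given by its vertex set \<open>V\<close> and its set \<open>E\<close> of edges, which are two-element sets.\<close>

definition simple_graph :: "'v set \<Rightarrow> 'v set set \<Rightarrow> bool" where
  "simple_graph V E \<longleftrightarrow> finite V \<and> (\<forall>e\<in>E. e \<subseteq> V \<and> card e = 2)"

definition connected_graph :: "'v set \<Rightarrow> 'v set set \<Rightarrow> bool" where
  "connected_graph V E \<longleftrightarrow> V \<noteq> {} \<and> (\<forall>u\<in>V. \<forall>v\<in>V. (u, v) \<in> {(x, y). {x, y} \<in> E}\<^sup>*)"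

definition closed_walk_edges :: "'v list \<Rightarrow> 'v set set" where
  "closed_walk_edges c = {{c ! i, c ! (Suc i mod length c)} | i. i < length c}"

definition is_cycle :: "'v set set \<Rightarrow> 'v list \<Rightarrow> bool" where
  "is_cycle E c \<longleftrightarrow> 3 \<le> length c \<and> distinct c \<and> closed_walk_edges c \<subseteq> E"

definition is_induced_cycle :: "'v set set \<Rightarrow> 'v list \<Rightarrow> bool" where
  "is_induced_cycle E c \<longleftrightarrow>
     is_cycle E c \<and> (\<forall>e\<in>E. e \<subseteq> set c \<longrightarrow> e \<in> closed_walk_edges c)"

text \<open>
  A cycle is a subgraph: vertex lists that differ by a rotation or a reversal describe the same one.
  Therefore cycles are counted through their edge sets, which also determine their vertex sets.
\<close>

definition induced_cycles :: "'v set set \<Rightarrow> 'v set set set" where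
  "induced_cycles E = closed_walk_edges ` {c. is_induced_cycle E c}"

definition unicyclic :: "'v set set \<Rightarrow> bool" where
  "unicyclic E \<longleftrightarrow> (\<exists>!C. C \<in> induced_cycles E)"

definition std_cycle :: "nat \<Rightarrow> nat set set" where
  "std_cycle n = {{i, i + 1} | i. i \<in> {1..n - 1}} \<union> {{1, n}}"


section \<open>Edge polynomials\<close>

definition KE :: "nat set set \<Rightarrow> 'a::field mpoly set" where
  "KE E = mpoly.span {Var i * Var j | i j. {i, j} \<in> E}"

definition num_terms :: "nat set set \<Rightarrow> 'a::zero mpoly \<Rightarrow> nat" where
  "num_terms E f =
     card {m. (\<exists>i j. {i, j} \<in> E \<and> m = Poly_Mapping.single i 1 + Poly_Mapping.single j 1) \<and>
              Poly_Mapping.lookup f m \<noteq> 0}"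

definition d_num :: "int \<Rightarrow> nat \<Rightarrow> int" where
  "d_num q m = (\<Sum>i = 1..m - 2. (-1) ^ (i + 1) * (q - 1) ^ (m - i)) - (q - 1) ^ (m - 2)"

end

theory Submission
  imports Defs "HOL-Library.Cardinality"
begin

text \<open>
  The terms of \<open>f\<close> form a subgraph \<open>S\<close> of \<open>G\<close>, and everything is decided by the shape of \<open>S\<close>.

  If an edge \<open>{b, x}\<close> of \<open>S\<close> has an end \<open>b\<close> that lies on no other edge of \<open>S\<close>, then \<open>f = \<alpha> t\<^sub>b t\<^sub>x + g\<close>
  where \<open>g\<close> does not involve \<open>t\<^sub>b\<close>. On the torus \<open>\<alpha> t\<^sub>x\<close> is a unit, so \<open>t\<^sub>b\<close> is determined by the other
  coordinates, and its value is non-zero exactly when \<open>g\<close> is non-zero. So the zeros of \<open>f\<close>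
  correspond to the non-zeros of \<open>g\<close> on the torus without \<open>t\<^sub>b\<close>. Iterating this complementation gives
  the alternating sums (\<open>card_edge_zeros_peel\<close>).

  A graph with a unique induced cycle has a unique cycle at all, since a chord splits a cycle into
  two different shorter ones (\<open>unicyclic_imp_unique_cycle\<close>). So if some cycle edge is absent from
  \<open>S\<close>, then \<open>S\<close> is a forest, which can be peeled down to one edge; a single monomial has no zeros on
  the torus. If \<open>S\<close> contains the whole cycle, it can be peeled down to the cycle: at the end of a
  longest path that leaves the cycle there is a pendant vertex (\<open>beyond_cycle_imp_pendant\<close>).

  There remains the form of an even cycle. As a polynomial in \<open>t\<^sub>n\<close> it is
  \<open>(\<alpha>\<^sub>n\<^sub>-\<^sub>1 t\<^sub>n\<^sub>-\<^sub>1 + c t\<^sub>1) t\<^sub>n + g\<close> with \<open>g\<close> the form of a path. Where the linear factor vanishes,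
  eliminating \<open>t\<^sub>n\<^sub>-\<^sub>1\<close> turns \<open>g\<close> into the form of a cycle on \<open>n - 2\<close> vertices with a new closing
  coefficient; elsewhere \<open>t\<^sub>n\<close> is determined. With \<open>Z\<^sub>m\<close> the number of zeros of the form on \<open>m\<close> vertices,
  this yields \<open>Z\<^sub>n = q Z\<^sub>n\<^sub>-\<^sub>2 + d\<^sub>n\<close> (\<open>card_cycle_zeros_step\<close>).
  The alternating product of the coefficients that decides between the two cases is invariant, up to
  a unit, under the step. The recursion ends at the
  degenerate cycle on two vertices, whose form \<open>(\<alpha>\<^sub>1 + c) t\<^sub>1 t\<^sub>2\<close> vanishes everywhere or nowhere on
  the torus.
\<close>


section \<open>Zeros on a torus, one coordinate at a time\<close>

lemma card_PiE_insert_Collect: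
  assumes "finite V" "finite A" "b \<notin> V"
  shows "card {P \<in> insert b V \<rightarrow>\<^sub>E A. \<Phi> P} = (\<Sum>Q\<in>V \<rightarrow>\<^sub>E A. card {y \<in> A. \<Phi> (Q(b := y))})"
proof -
  let ?T = "SIGMA Q : (V \<rightarrow>\<^sub>E A). {y \<in> A. \<Phi> (Q(b := y))}"
  \<comment> \<open>Resetting the coordinate \<open>b\<close> to \<^const>\<open>undefined\<close> restores extensionality on \<open>V\<close>.\<close>
  have "bij_betw (\<lambda>(Q, y). Q(b := y)) ?T {P \<in> insert b V \<rightarrow>\<^sub>E A. \<Phi> P}"
  proof (rule bij_betw_byWitness[where f' = "\<lambda>P. (P(b := undefined), P b)"])
    show "\<forall>p\<in>?T. (\<lambda>P. (P(b := undefined), P b)) ((\<lambda>(Q, y). Q(b := y)) p) = p"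
      using assms(3) by (auto simp: PiE_iff extensional_def fun_eq_iff)
    show "(\<lambda>(Q, y). Q(b := y)) ` ?T \<subseteq> {P \<in> insert b V \<rightarrow>\<^sub>E A. \<Phi> P}"
      by (auto simp: PiE_iff extensional_def)
    show "(\<lambda>P. (P(b := undefined), P b)) ` {P \<in> insert b V \<rightarrow>\<^sub>E A. \<Phi> P} \<subseteq> ?T"
      using assms(3) by (auto simp: PiE_iff extensional_def)
  qed auto
  then have "card {P \<in> insert b V \<rightarrow>\<^sub>E A. \<Phi> P} = card ?T"
    by (simp add: bij_betw_same_card)
  also have "\<dots> = (\<Sum>Q\<in>V \<rightarrow>\<^sub>E A. card {y \<in> A. \<Phi> (Q(b := y))})"
    using assms by (intro card_SigmaI) (auto intro: finite_PiE)
  finally show ?thesis .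
qed

lemma card_nonzero: "int (card (UNIV - {0 :: 'a::{finite,field}})) = int CARD('a) - 1"
  using card_Suc_Diff1[OF finite UNIV_I, of "0 :: 'a"] by linarith

lemma card_torus:
  "finite V \<Longrightarrow> int (card (V \<rightarrow>\<^sub>E (UNIV - {0 :: 'a::{finite,field}}))) = (int CARD('a) - 1) ^ card V"
  by (simp only: card_PiE prod_constant of_nat_power card_nonzero)

text \<open>
  Written with indicators, so that summing over the remaining coordinates turns each term into the
  cardinality of a zero set.
\<close>

lemma card_affine_roots:
  fixes L g :: "'a::{finite,field}"
  shows "int (card {y \<in> UNIV - {0}. L * y + g = 0})
    = 1 - of_bool (L = 0) - of_bool (g = 0) + int CARD('a) * of_bool (L = 0 \<and> g = 0)"
proof (cases "L = 0")
  case True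
  show ?thesis
  proof (cases "g = 0")
    case True
    then have "{y \<in> UNIV - {0}. L * y + g = 0} = UNIV - {0}"
      using \<open>L = 0\<close> by auto
    then show ?thesis using True \<open>L = 0\<close> card_nonzero[where 'a='a] by simp
  qed (use True in simp)
next
  case False
  then have "L * y + g = 0 \<longleftrightarrow> y = - g / L" for y
    by (simp add: field_simps eq_neg_iff_add_eq_0)
  then have "{y \<in> UNIV - {0}. L * y + g = 0} = (if g = 0 then {} else {- g / L})"
    using False by auto
  then show ?thesis using False by simp
qed

text \<open>
  Both reduction steps, for a pendant vertex and for a vertex of a cycle, single out a coordinate in
  which the form is affine: slope \<open>L\<close> and constant term \<open>g\<close> depend on the other coordinates only.
  A fibre is full if both vanish, empty if exactly one does, and a point otherwise.
\<close>

lemma card_affine_extension: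
  fixes \<Phi> :: "('v \<Rightarrow> 'a::{finite,field}) \<Rightarrow> bool" and L g :: "('v \<Rightarrow> 'a) \<Rightarrow> 'a"
  assumes V: "finite V" "b \<notin> V"
    and \<Phi>: "\<And>Q y. Q \<in> V \<rightarrow>\<^sub>E (UNIV - {0}) \<Longrightarrow> y \<noteq> 0 \<Longrightarrow> \<Phi> (Q(b := y)) \<longleftrightarrow> L Q * y + g Q = 0"
  shows "int (card {P \<in> insert b V \<rightarrow>\<^sub>E (UNIV - {0}). \<Phi> P})
    = (int CARD('a) - 1) ^ card V
      - int (card {Q \<in> V \<rightarrow>\<^sub>E (UNIV - {0}). L Q = 0})
      - int (card {Q \<in> V \<rightarrow>\<^sub>E (UNIV - {0}). g Q = 0})
      + int CARD('a) * int (card {Q \<in> V \<rightarrow>\<^sub>E (UNIV - {0}). L Q = 0 \<and> g Q = 0})"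
proof -
  let ?X = "V \<rightarrow>\<^sub>E (UNIV - {0 :: 'a})"
  have fin: "finite ?X" using V by (auto intro: finite_PiE)
  have count: "(\<Sum>Q\<in>?X. of_bool (R Q)) = int (card (?X \<inter> {Q. R Q}))" for R
    by (rule sum_of_bool_eq[OF fin fin])
  have Int: "?X \<inter> {Q. R Q} = {Q \<in> ?X. R Q}" for R by auto
  have "int (card {P \<in> insert b V \<rightarrow>\<^sub>E (UNIV - {0}). \<Phi> P})
      = (\<Sum>Q\<in>?X. int (card {y \<in> UNIV - {0}. \<Phi> (Q(b := y))}))"
    using V by (subst card_PiE_insert_Collect) auto
  also have "\<dots> = (\<Sum>Q\<in>?X. int (card {y \<in> UNIV - {0}. L Q * y + g Q = 0}))"
    by (intro sum.cong refl arg_cong[where f = "\<lambda>B. int (card B)"]) (use \<Phi> in auto)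
  also have "\<dots> = (\<Sum>Q\<in>?X. 1 - of_bool (L Q = 0) - of_bool (g Q = 0)
                     + int CARD('a) * of_bool (L Q = 0 \<and> g Q = 0))"
    by (simp only: card_affine_roots)
  also have "\<dots> = int (card ?X) - int (card (?X \<inter> {Q. L Q = 0})) - int (card (?X \<inter> {Q. g Q = 0}))
      + int CARD('a) * int (card (?X \<inter> {Q. L Q = 0 \<and> g Q = 0}))"
    by (simp only: sum.distrib sum_subtractf sum_distrib_left[symmetric] count sum_constant mult_1_right)
  finally show ?thesis
    unfolding Int card_torus[OF V(1)] .
qed

lemma PiE_Collect_linear_root:
  fixes g :: "('v \<Rightarrow> 'a::{finite,field}) \<Rightarrow> 'a"
  assumes V: "finite V" "b \<notin> V" and g: "\<And>Q. Q \<in> V \<rightarrow>\<^sub>E (UNIV - {0}) \<Longrightarrow> g Q \<noteq> 0"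
    and \<Phi>: "\<And>Q y. Q \<in> V \<rightarrow>\<^sub>E (UNIV - {0}) \<Longrightarrow> \<Phi> (Q(b := y)) \<longleftrightarrow> y = g Q \<and> \<Psi> Q"
  shows "card {P \<in> insert b V \<rightarrow>\<^sub>E (UNIV - {0}). \<Phi> P} = card {Q \<in> V \<rightarrow>\<^sub>E (UNIV - {0}). \<Psi> Q}"
proof -
  let ?X = "V \<rightarrow>\<^sub>E (UNIV - {0 :: 'a})"
  have fin: "finite ?X" using V by (auto intro: finite_PiE)
  have "card {P \<in> insert b V \<rightarrow>\<^sub>E (UNIV - {0}). \<Phi> P}
      = (\<Sum>Q\<in>?X. card {y \<in> UNIV - {0}. \<Phi> (Q(b := y))})"
    using V by (subst card_PiE_insert_Collect) auto
  also have "\<dots> = (\<Sum>Q\<in>?X. of_bool (\<Psi> Q))"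
  proof (rule sum.cong[OF refl])
    fix Q assume Q: "Q \<in> ?X"
    then have "{y \<in> UNIV - {0}. \<Phi> (Q(b := y))} = (if \<Psi> Q then {g Q} else {})"
      using \<Phi> g by auto
    then show "card {y \<in> UNIV - {0}. \<Phi> (Q(b := y))} = of_bool (\<Psi> Q)" by simp
  qed
  also have "\<dots> = card (?X \<inter> {Q. \<Psi> Q})"
    by (subst sum_of_bool_eq[OF fin fin]) simp
  also have "?X \<inter> {Q. \<Psi> Q} = {Q \<in> ?X. \<Psi> Q}" by auto
  finally show ?thesis .
qed


section \<open>Peeling pendant edges\<close>

text \<open>
  The weights \<open>a\<close> are a function on all sets, so that edges can be removed from \<open>S\<close> without
  changing them.
\<close>

definition edge_form :: "('v set \<Rightarrow> 'a::comm_semiring_1) \<Rightarrow> 'v set set \<Rightarrow> ('v \<Rightarrow> 'a) \<Rightarrow> 'a" where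
  "edge_form a S P = (\<Sum>e\<in>S. a e * (\<Prod>i\<in>e. P i))"

definition edge_zeros :: "('v set \<Rightarrow> 'a::comm_semiring_1) \<Rightarrow> 'v set \<Rightarrow> 'v set set \<Rightarrow> ('v \<Rightarrow> 'a) set" where
  "edge_zeros a V S = {P \<in> V \<rightarrow>\<^sub>E (UNIV - {0}). edge_form a S P = 0}"

lemma edge_form_fun_upd:
  "b \<notin> \<Union>S \<Longrightarrow> edge_form a S (P(b := y)) = edge_form a S P"
  unfolding edge_form_def by (intro sum.cong refl arg_cong2[where f = times] prod.cong) auto

lemma card_edge_zeros_free_vertex:
  fixes a :: "'v set \<Rightarrow> 'a::{finite,field}"
  assumes "finite V" "b \<notin> V" "\<Union>S \<subseteq> V"
  shows "int (card (edge_zeros a (insert b V) S))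
    = (int CARD('a) - 1) * int (card (edge_zeros a V S))"
proof -
  have eq: "edge_form a S (P(b := y)) = 0 \<longleftrightarrow> 0 * y + edge_form a S P = 0" for P y
  proof -
    have "b \<notin> \<Union>S" using assms by blast
    then show ?thesis by (simp add: edge_form_fun_upd[of b S a P y])
  qed
  show ?thesis
    unfolding edge_zeros_def
    by (subst card_affine_extension[OF assms(1,2), where L = "\<lambda>_. 0" and g = "edge_form a S"])
       (use eq in simp, simp add: algebra_simps card_torus assms)
qed

lemma card_edge_zeros_free_vertices:
  fixes a :: "'v set \<Rightarrow> 'a::{finite,field}"
  assumes "finite V" "U \<subseteq> V" "\<Union>S \<subseteq> U"
  shows "int (card (edge_zeros a V S))
    = (int CARD('a) - 1) ^ (card V - card U) * int (card (edge_zeros a U S))"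
proof -
  have "int (card (edge_zeros a (U \<union> W) S))
      = (int CARD('a) - 1) ^ card W * int (card (edge_zeros a U S))"
    if "finite W" "W \<inter> U = {}" for W
    using that
  proof (induction W)
    case (insert b W)
    then have "int (card (edge_zeros a (insert b (U \<union> W)) S))
        = (int CARD('a) - 1) * int (card (edge_zeros a (U \<union> W) S))"
      using assms finite_subset[of U V] by (intro card_edge_zeros_free_vertex) auto
    with insert show ?case by simp
  qed simp
  from this[of "V - U"] have "int (card (edge_zeros a V S))
      = (int CARD('a) - 1) ^ card (V - U) * int (card (edge_zeros a U S))"
    using assms by (auto simp: Un_absorb1)
  then show ?thesis
    using assms finite_subset[of U V] by (simp add: card_Diff_subset)
qed

definition pendant :: "'v set set \<Rightarrow> 'v \<Rightarrow> 'v set \<Rightarrow> bool" where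
  "pendant S b e \<longleftrightarrow> e \<in> S \<and> b \<in> e \<and> (\<forall>e'\<in>S. b \<in> e' \<longrightarrow> e' = e)"

text \<open>
  The slope of the form in the coordinate \<open>b\<close> is a product of units, so the zeros are the graph of
  a function over the non-zeros of the form without the edge \<open>e\<close>.
\<close>

lemma card_edge_zeros_pendant:
  fixes a :: "'v set \<Rightarrow> 'a::{finite,field}"
  assumes V: "finite V" "\<Union>S \<subseteq> V" and S: "\<And>e. e \<in> S \<Longrightarrow> a e \<noteq> 0" and b: "pendant S b e"
  shows "int (card (edge_zeros a V S))
    = (int CARD('a) - 1) ^ (card V - 1) - int (card (edge_zeros a (V - {b}) (S - {e})))"
proof -
  let ?W = "V - {b}" and ?L = "\<lambda>P. a e * (\<Prod>i\<in>e - {b}. P i)"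
  have e: "e \<in> S" "b \<in> e" "e \<subseteq> V" "finite e" "b \<in> V" and S': "b \<notin> \<Union>(S - {e})"
    using b V by (auto simp: pendant_def intro: finite_subset)
  have "finite S" using V by (meson finite_Pow_iff finite_subset subset_Pow_Union)
  have split: "edge_form a S (Q(b := y)) = 0 \<longleftrightarrow> ?L Q * y + edge_form a (S - {e}) Q = 0" for Q y
  proof -
    have "edge_form a S (Q(b := y))
        = a e * (\<Prod>i\<in>e. (Q(b := y)) i) + edge_form a (S - {e}) (Q(b := y))"
      using \<open>finite S\<close> e unfolding edge_form_def by (simp add: sum.remove)
    moreover have "(\<Prod>i\<in>e. (Q(b := y)) i) = y * (\<Prod>i\<in>e - {b}. Q i)"
      using e by (simp add: prod.remove[of e b])
    ultimately show ?thesis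
      using edge_form_fun_upd[OF S', of a Q y] by (simp add: ac_simps)
  qed
  have "?L Q \<noteq> 0" if "Q \<in> ?W \<rightarrow>\<^sub>E (UNIV - {0})" for Q
    using that e S by (auto simp: PiE_iff)
  then have none: "{Q \<in> ?W \<rightarrow>\<^sub>E (UNIV - {0}). ?L Q = 0} = {}"
    "{Q \<in> ?W \<rightarrow>\<^sub>E (UNIV - {0}). ?L Q = 0 \<and> R Q} = {}" for R by blast+
  have "int (card (edge_zeros a (insert b ?W) S))
      = (int CARD('a) - 1) ^ card ?W - int (card (edge_zeros a ?W (S - {e})))"
    unfolding edge_zeros_def
    by (subst card_affine_extension[where L = ?L and g = "edge_form a (S - {e})"])
       (simp_all only: V none split finite_Diff, simp_all)
  then show ?thesis using e V by (simp add: insert_absorb)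
qed

lemma alternating_power_sum_Suc:
  "(\<Sum>i = 1..Suc m. (-1) ^ (i + 1) * (x :: int) ^ (N - i))
    = x ^ (N - 1) - (\<Sum>i = 1..m. (-1) ^ (i + 1) * x ^ (N - 1 - i))"
proof -
  have "(\<Sum>i = 1..Suc m. (-1) ^ (i + 1) * x ^ (N - i))
      = x ^ (N - 1) + (\<Sum>i = 2..Suc m. (-1) ^ (i + 1) * x ^ (N - i))"
    by (simp add: sum.atLeast_Suc_atMost numeral_2_eq_2)
  also have "(\<Sum>i = 2..Suc m. (-1) ^ (i + 1) * x ^ (N - i))
      = (\<Sum>i = 1..m. (-1) ^ (Suc i + 1) * x ^ (N - Suc i))"
    using sum.shift_bounds_cl_Suc_ivl[of "\<lambda>i. (-1) ^ (i + 1) * x ^ (N - i)" 1 m]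
    by (simp add: numeral_2_eq_2)
  finally show ?thesis by (simp add: sum_negf)
qed

text \<open>
  The invariant \<open>Q\<close> describes the graphs met while peeling and \<open>m\<close> is the number of edges of the
  core at which it stops. A vertex disappears together with each edge, so \<open>card V - card S\<close> stays
  constant, and each step complements the count inside a smaller torus; this alternation of signs
  is that of the sum. For forests the core is a single edge and \<open>z = 0\<close>, for unicyclic graphs it
  is the cycle.
\<close>

lemma card_edge_zeros_peel:
  fixes a :: "'v set \<Rightarrow> 'a::{finite,field}" and z :: int
  assumes a: "\<And>e. e \<in> S \<Longrightarrow> a e \<noteq> 0"
    and leaf: "\<And>T. Q T \<Longrightarrow> m < card T \<Longrightarrow> \<exists>b e. pendant T b e \<and> Q (T - {e})"
    and core: "\<And>T V. Q T \<Longrightarrow> card T = m \<Longrightarrow> T \<subseteq> S \<Longrightarrow> finite V \<Longrightarrow> \<Union>T \<subseteq> V \<Longrightarrow>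
      int (card (edge_zeros a V T)) = (int CARD('a) - 1) ^ (card V - m) * z"
    and S: "finite V" "\<Union>S \<subseteq> V" "Q S" "m \<le> card S"
  shows "int (card (edge_zeros a V S))
    = (-1) ^ (card S - m) * (int CARD('a) - 1) ^ (card V - card S) * z
      + (\<Sum>i = 1..card S - m. (-1) ^ (i + 1) * (int CARD('a) - 1) ^ (card V - i))"
  using a core S
proof (induction "card S - m" arbitrary: S V)
  case 0
  then have "card S = m" by simp
  with 0 show ?case by simp
next
  case (Suc j)
  let ?x = "int CARD('a) - 1"
  have lt: "m < card S" using Suc.hyps(2) by simp
  with leaf Suc.prems obtain b e where b: "pendant S b e" and Q: "Q (S - {e})" by blast
  have "finite S" using lt card_ge_0_finite[of S] by linarith
  have e: "e \<in> S" "b \<in> V" using b Suc.prems(4) by (auto simp: pendant_def)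
  have cS: "card (S - {e}) = m + j" "card S = Suc (m + j)"
    using e \<open>finite S\<close> Suc.hyps(2) lt by auto
  have cV: "card (V - {b}) = card V - 1" "0 < card V"
    using e Suc.prems(3) by (auto simp: card_gt_0_iff)
  have "int (card (edge_zeros a (V - {b}) (S - {e})))
    = (-1) ^ (card (S - {e}) - m) * ?x ^ (card (V - {b}) - card (S - {e})) * z
      + (\<Sum>i = 1..card (S - {e}) - m. (-1) ^ (i + 1) * ?x ^ (card (V - {b}) - i))"
  proof (rule Suc.hyps(1))
    show "\<Union>(S - {e}) \<subseteq> V - {b}" using b Suc.prems(4) by (auto simp: pendant_def)
    fix T U assume "Q T" "card T = m" "T \<subseteq> S - {e}" "finite U" "\<Union>T \<subseteq> U"
    then show "int (card (edge_zeros a U T)) = ?x ^ (card U - m) * z"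
      using Suc.prems(2) by blast
  qed (use Suc.prems(1,3) Q cS in auto)
  moreover have "int (card (edge_zeros a V S))
      = ?x ^ (card V - 1) - int (card (edge_zeros a (V - {b}) (S - {e})))"
    using Suc.prems(3,4,1) b by (rule card_edge_zeros_pendant)
  moreover have "card V - 1 - (m + j) = card V - card S" "card S - m = Suc j" "m + j - m = j"
    using cS by auto
  ultimately show ?case
    by (simp only: cS(1) cV(1) alternating_power_sum_Suc power_Suc algebra_simps)
qed


section \<open>Cycles and pendant vertices of unicyclic graphs\<close>

lemma Union_closed_walk_edges: "\<Union>(closed_walk_edges c) = set c"
proof
  show "\<Union>(closed_walk_edges c) \<subseteq> set c"
  proof (rule Union_least)
    fix e assume "e \<in> closed_walk_edges c"
    then obtain i where "e = {c ! i, c ! (Suc i mod length c)}" "i < length c"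
      by (auto simp: closed_walk_edges_def)
    moreover have "Suc i mod length c < length c" 
      by (rule mod_less_divisor) (use \<open>i < length c\<close> in linarith)
    ultimately show "e \<subseteq> set c" using nth_mem by blast
  qed
  show "set c \<subseteq> \<Union>(closed_walk_edges c)"
  proof
    fix x assume "x \<in> set c"
    then obtain i where "i < length c" "c ! i = x" by (auto simp: in_set_conv_nth)
    then show "x \<in> \<Union>(closed_walk_edges c)" unfolding closed_walk_edges_def by blast
  qed
qed

text \<open>
  Replaces indices modulo the length by a condition on neighbours in the list, which is compatible
  with appending lists.
\<close>

lemma closed_walk_edges_subset_iff:
  assumes "c \<noteq> []"
  shows "closed_walk_edges c \<subseteq> E \<longleftrightarrow> successively (\<lambda>x y. {x, y} \<in> E) c \<and> {last c, hd c} \<in> E"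
proof -
  obtain m where m: "length c = Suc m" using assms by (cases c) auto
  have "closed_walk_edges c \<subseteq> E \<longleftrightarrow> (\<forall>i<Suc m. {c ! i, c ! (Suc i mod length c)} \<in> E)"
    by (auto simp: closed_walk_edges_def m)
  also have "\<dots> \<longleftrightarrow> (\<forall>i<m. {c ! i, c ! Suc i} \<in> E) \<and> {c ! m, c ! 0} \<in> E"
    unfolding All_less_Suc by (auto simp: m)
  finally show ?thesis
    using assms m by (auto simp: successively_conv_nth last_conv_nth hd_conv_nth)
qed

lemma is_cycle_iff:
  "is_cycle E c \<longleftrightarrow> 3 \<le> length c \<and> distinct c \<and>
    successively (\<lambda>x y. {x, y} \<in> E) c \<and> {last c, hd c} \<in> E"
  unfolding is_cycle_def using closed_walk_edges_subset_iff[of c E]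
  by (cases "c = []") auto

lemma closed_walk_edges_step:
  assumes "A @ u # v # D = c" shows "{u, v} \<in> closed_walk_edges c"
  using closed_walk_edges_subset_iff[of c "closed_walk_edges c"] assms
  by (auto simp: successively_append_iff)

lemma is_cycle_mono: "is_cycle S c \<Longrightarrow> S \<subseteq> E \<Longrightarrow> is_cycle E c"
  unfolding is_cycle_def by blast

text \<open>
  Two steps of the walk could only share their edge by traversing it in opposite directions, which
  forces length two.
\<close>

lemma card_closed_walk_edges:
  assumes "is_cycle E c" shows "card (closed_walk_edges c) = length c"
proof -
  let ?n = "length c"
  have c: "3 \<le> ?n" "distinct c" using assms by (auto simp: is_cycle_def)
  have "inj_on (\<lambda>i. {c ! i, c ! (Suc i mod ?n)}) {..<?n}"
  proof (rule inj_onI)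
    fix i j
    assume ij: "i \<in> {..<?n}" "j \<in> {..<?n}"
      and eq: "{c ! i, c ! (Suc i mod ?n)} = {c ! j, c ! (Suc j mod ?n)}"
    have "Suc i mod ?n < ?n" "Suc j mod ?n < ?n"
      by (rule mod_less_divisor, use c in linarith)+
    then have "i = j \<or> i = Suc j mod ?n \<and> Suc i mod ?n = j"
      using eq ij c(2) unfolding doubleton_eq_iff by (auto simp: nth_eq_iff_index_eq)
    then show "i = j"
      using c(1) ij by (auto simp: mod_Suc split: if_splits)
  qed
  moreover have "closed_walk_edges c = (\<lambda>i. {c ! i, c ! (Suc i mod ?n)}) ` {..<?n}"
    unfolding closed_walk_edges_def by auto
  ultimately show ?thesis by (simp add: card_image)
qed

lemma closed_walk_edges_upt:
  assumes "2 \<le> n" shows "closed_walk_edges [1..<Suc n] = std_cycle n"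
proof -
  obtain m where n: "n = Suc m" using assms by (cases n) auto
  have nth: "[1..<Suc n] ! i = Suc i" if "i < n" for i
    using that by (simp add: nth_upt del: upt_Suc)
  have "closed_walk_edges [1..<Suc n]
      = (\<lambda>i. {[1..<Suc n] ! i, [1..<Suc n] ! (Suc i mod n)}) ` {..<n}"
    unfolding closed_walk_edges_def by auto
  also have "\<dots> = (\<lambda>i. {Suc i, Suc (Suc i mod n)}) ` {..<n}"
  proof (rule image_cong)
    fix i assume "i \<in> {..<n}"
    then have "i < n" "Suc i mod n < n" by auto
    then show "{[1..<Suc n] ! i, [1..<Suc n] ! (Suc i mod n)} = {Suc i, Suc (Suc i mod n)}"
      by (simp only: nth)
  qed simp
  also have "\<dots> = (\<lambda>i. {Suc i, Suc (Suc i mod n)}) ` {..<m} \<union> {{1, n}}"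
    unfolding n lessThan_Suc by (simp add: insert_commute)
  also have "(\<lambda>i. {Suc i, Suc (Suc i mod n)}) ` {..<m} = (\<lambda>i. {i, i + 1}) ` Suc ` {..<m}"
    unfolding image_image by (intro image_cong) (auto simp: n)
  also have "Suc ` {..<m} = {1..n - 1}"
    by (simp add: n image_Suc_lessThan)
  finally show ?thesis
    unfolding std_cycle_def by blast
qed

text \<open>
  Induction on the length. A cycle that is not induced has a chord \<open>{u, v}\<close>, which closes each of its
  two arcs to a shorter cycle. By induction both would coincide with the induced cycle,
  but an inner vertex of one arc does not lie on the other.
\<close>

lemma unicyclic_imp_unique_cycle:
  assumes E: "unicyclic E" "\<And>e. e \<in> E \<Longrightarrow> card e = 2" and c0: "is_induced_cycle E c0"
  shows "is_cycle E c \<Longrightarrow> closed_walk_edges c = closed_walk_edges c0"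
proof (induction "length c" arbitrary: c rule: less_induct)
  case less
  show ?case
  proof (cases "is_induced_cycle E c")
    case True
    with E(1) c0 show ?thesis unfolding unicyclic_def induced_cycles_def by blast
  next
    case False
    with less.prems obtain e where e: "e \<in> E" "e \<subseteq> set c" "e \<notin> closed_walk_edges c"
      unfolding is_induced_cycle_def by blast
    then obtain x y where xy: "e = {x, y}" "x \<noteq> y"
      using E(2) by (meson card_2_iff)
    have "\<exists>u v A B D. e = {u, v} \<and> c = A @ u # B @ v # D"
    proof -
      obtain A B where AB: "c = A @ x # B" using e xy by (meson insert_subset split_list)
      then consider "y \<in> set A" | "y \<in> set B" using e xy by auto
      then show ?thesis
      proof cases
        case 1
        then obtain A1 A2 where "A = A1 @ y # A2" by (meson split_list)
        then show ?thesis using AB xy by (metis append.assoc append_Cons insert_commute)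
      next
        case 2
        then obtain B1 B2 where "B = B1 @ y # B2" by (meson split_list)
        then show ?thesis using AB xy by blast
      qed
    qed
    then obtain u v A B D where uv: "e = {u, v}" "c = A @ u # B @ v # D" by blast
    have B: "B \<noteq> []"
    proof
      assume "B = []"
      then show False using closed_walk_edges_step[of A u v D c] uv e(3) by simp
    qed
    have AD: "A \<noteq> [] \<or> D \<noteq> []"
    proof (rule ccontr)
      assume "\<not> ?thesis"
      then have "{last c, hd c} = e" "c \<noteq> []" using uv by auto
      then show False using closed_walk_edges_subset_iff[of c "closed_walk_edges c"] e(3) by auto
    qed
    have c: "distinct c" "successively (\<lambda>x y. {x, y} \<in> E) c" "{last c, hd c} \<in> E"
      using less.prems by (simp_all add: is_cycle_iff)
    \<comment> \<open>The chord \<open>{u, v}\<close> closes the arc from \<open>u\<close> to \<open>v\<close> and shortcuts it in the other cycle.\<close>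
    let ?c1 = "u # B @ [v]" and ?c2 = "A @ u # v # D"
    have "{u, v} \<in> E" "{v, u} \<in> E"
      using e(1) uv(1) by (simp_all add: insert_commute)
    moreover have "3 \<le> length ?c1" "3 \<le> length ?c2"
      using B AD by (cases B; cases A; cases D; simp)+
    moreover have "hd ?c2 = hd c" "last ?c2 = last c"
      using uv(2) by (cases A; simp)+
    ultimately have "is_cycle E ?c1" "is_cycle E ?c2"
      using c B unfolding is_cycle_iff uv(2)
      by (auto simp: successively_append_iff successively_Cons)
    moreover have "length ?c1 < length c" "length ?c2 < length c"
      using uv AD B by (auto simp: neq_Nil_conv)
    ultimately have "closed_walk_edges ?c1 = closed_walk_edges ?c2"
      using less.hyps by metis
    then have "set ?c1 = set ?c2" by (metis Union_closed_walk_edges)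
    moreover have "hd B \<in> set ?c1" "hd B \<notin> set ?c2"
      using B less.prems uv by (auto simp: is_cycle_def neq_Nil_conv)
    ultimately show ?thesis by simp
  qed
qed

text \<open>
  Extend the path as long as possible. At its last vertex \<open>x\<close> an edge that is not the last one of the
  path either leads to a new vertex or back to the path; in the latter case it closes a cycle through
  \<open>x\<close>, although all cycles live in \<open>D\<close>. The path covers \<open>D\<close> from the start, so no extension enters
  \<open>D\<close>. For forests \<open>D\<close> is empty, for unicyclic graphs it is the vertex set of the cycle.
\<close>

lemma path_imp_pendant:
  assumes "finite V" "\<Union>S \<subseteq> V" "\<And>e. e \<in> S \<Longrightarrow> card e = 2"
    and D: "\<And>c. is_cycle S c \<Longrightarrow> set c \<subseteq> D"
    and p: "distinct p" "successively (\<lambda>x y. {x, y} \<in> S) p" "2 \<le> length p" "set p \<subseteq> V"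
      "D \<subseteq> set p" "last p \<notin> D"
  shows "\<exists>b e. pendant S b e \<and> b \<notin> D"
  using p
proof (induction "card V - length p" arbitrary: p rule: less_induct)
  case less
  obtain xs x y where p: "p = xs @ [y, x]"
  proof -
    from less.prems(3) obtain q x where q: "p = q @ [x]" by (cases p rule: rev_cases) auto
    with less.prems(3) obtain xs y where "q = xs @ [y]" by (cases q rule: rev_cases) auto
    with q that show ?thesis by simp
  qed
  have yx: "{y, x} \<in> S" using less.prems p by (auto simp: successively_append_iff)
  show ?case
  proof (cases "pendant S x {y, x}")
    case True
    then show ?thesis using less.prems p by auto
  next
    case False
    then obtain e where e: "e \<in> S" "x \<in> e" "e \<noteq> {y, x}" using yx by (auto simp: pendant_def)
    then obtain w where w: "e = {x, w}" "w \<noteq> x" 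
      using assms(3)[of e] by (auto simp: card_2_iff insert_commute)
    then have "w \<noteq> y" "w \<in> V" using e assms(2) by (auto simp: insert_commute)
    show ?thesis
    proof (cases "w \<in> set p")
      case True
      then obtain A B where "xs = A @ w # B"
        using w \<open>w \<noteq> y\<close> p by (metis Un_iff append_Cons empty_iff insert_iff list.set set_append split_list)
      then have "is_cycle S (w # B @ [y, x])"
        using less.prems p e w by (auto simp: is_cycle_iff successively_append_iff successively_Cons)
      then have "x \<in> D" using D by force
      then show ?thesis using less.prems p by simp
    next
      case False
      show ?thesis
      proof (rule less.hyps[of "p @ [w]"])
        have "card (set (p @ [w])) \<le> card V"
          using less.prems \<open>w \<in> V\<close> assms(1) by (intro card_mono) auto
        then show "card V - length (p @ [w]) < card V - length p"
          using less.prems False by (simp add: distinct_card)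
      qed (use less.prems False p e w \<open>w \<in> V\<close> in \<open>auto simp: successively_append_iff\<close>)
    qed
  qed
qed

lemma acyclic_imp_pendant:
  assumes "finite V" "\<Union>S \<subseteq> V" "\<And>e. e \<in> S \<Longrightarrow> card e = 2"
    and "\<And>c. \<not> is_cycle S c" "S \<noteq> {}"
  shows "\<exists>b e. pendant S b e"
proof -
  obtain x y where "{x, y} \<in> S" "x \<noteq> y" using assms(3,5) by (metis card_2_iff ex_in_conv)
  then show ?thesis
    using path_imp_pendant[of V S "{}" "[x, y]"] assms by auto
qed

text \<open>
  If an edge \<open>{u, v}\<close> leaves the cycle at \<open>u\<close>, a path that runs around the whole cycle, ends its
  tour at \<open>u\<close> and steps to \<open>v\<close> can be extended to a pendant vertex. Otherwise the edges
  that are not on the cycle form a forest disjoint from it.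
\<close>

lemma beyond_cycle_imp_pendant:
  assumes V: "finite V" "\<Union>S \<subseteq> V" "\<And>e. e \<in> S \<Longrightarrow> card e = 2"
    and c0: "is_induced_cycle S c0"
    and D: "\<And>c. is_cycle S c \<Longrightarrow> set c \<subseteq> set c0"
    and ne: "S \<noteq> closed_walk_edges c0"
  shows "\<exists>b e. pendant S b e \<and> b \<notin> set c0"
proof (cases "\<exists>u v. {u, v} \<in> S \<and> u \<in> set c0 \<and> v \<notin> set c0")
  case True
  then obtain u v where uv: "{u, v} \<in> S" "u \<in> set c0" "v \<notin> set c0" by blast
  then obtain A B where c: "c0 = A @ u # B" by (meson split_list)
  have cyc: "is_cycle S c0" using c0 by (simp add: is_induced_cycle_def)
  have "successively (\<lambda>x y. {x, y} \<in> S) (B @ A @ [u, v])"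
    using cyc uv(1) unfolding c is_cycle_iff
    by (auto simp: successively_append_iff successively_Cons hd_append split: if_splits)
  moreover have "set c0 \<subseteq> V"
    using cyc V(2) Union_closed_walk_edges[of c0] unfolding is_cycle_def by blast
  moreover have "distinct (B @ A @ [u, v])" "2 \<le> length (B @ A @ [u, v])"
    using cyc uv unfolding c is_cycle_def by auto
  moreover have "set (B @ A @ [u, v]) \<subseteq> V"
    using \<open>set c0 \<subseteq> V\<close> uv(1) V(2) unfolding c by auto
  moreover have "set c0 \<subseteq> set (B @ A @ [u, v])" "last (B @ A @ [u, v]) \<notin> set c0"
    using uv(3) unfolding c by auto
  ultimately show ?thesis
    using path_imp_pendant[OF V D, of "B @ A @ [u, v]"] by blast
next
  case False
  let ?S = "S - closed_walk_edges c0"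
  have sub: "closed_walk_edges c0 \<subseteq> S" using c0 by (auto simp: is_induced_cycle_def is_cycle_def)
  have disj: "e \<inter> set c0 = {}" if "e \<in> ?S" for e
  proof -
    have "\<not> e \<subseteq> set c0" using that c0 by (auto simp: is_induced_cycle_def)
    have "e \<in> S" using that by blast
    then obtain x y where xy: "e = {x, y}" using V(3) by (metis card_2_iff)
    then have "{x, y} \<in> S" "{y, x} \<in> S"
      using \<open>e \<in> S\<close> by (simp_all add: insert_commute)
    with False xy \<open>\<not> e \<subseteq> set c0\<close> show ?thesis by blast
  qed
  have "\<not> is_cycle ?S c" for c
  proof
    assume c: "is_cycle ?S c"
    then have "set c \<subseteq> set c0" using D is_cycle_mono by blast
    moreover have "set c \<inter> set c0 = {}" 
      using c disj unfolding is_cycle_def by (subst Union_closed_walk_edges[symmetric]) blast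
    ultimately have "c = []" by (metis inf.absorb_iff1 set_empty)
    then show False using c by (simp add: is_cycle_def)
  qed
  then obtain b e where b: "pendant ?S b e"
    using acyclic_imp_pendant[of V ?S] V ne sub by blast
  then have "b \<notin> set c0" using disj by (auto simp: pendant_def)
  with b have "pendant S b e"
    using Union_closed_walk_edges[of c0] by (auto simp: pendant_def)
  with \<open>b \<notin> set c0\<close> show ?thesis by blast
qed


section \<open>Zeros of edge forms of acyclic and unicyclic graphs\<close>

lemma card_edge_zeros_acyclic:
  fixes a :: "'v set \<Rightarrow> 'a::{finite,field}"
  assumes V: "finite V" "\<Union>S \<subseteq> V" "\<And>e. e \<in> S \<Longrightarrow> card e = 2"
    and a: "\<And>e. e \<in> S \<Longrightarrow> a e \<noteq> 0"
    and S: "\<And>c. \<not> is_cycle S c" "S \<noteq> {}"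
  shows "int (card (edge_zeros a V S))
    = (\<Sum>i = 1..card S - 1. (-1) ^ (i + 1) * (int CARD('a) - 1) ^ (card V - i))"
proof -
  have "finite S" using V by (meson finite_Pow_iff finite_subset subset_Pow_Union)
  have "int (card (edge_zeros a V S))
    = (-1) ^ (card S - 1) * (int CARD('a) - 1) ^ (card V - card S) * 0
      + (\<Sum>i = 1..card S - 1. (-1) ^ (i + 1) * (int CARD('a) - 1) ^ (card V - i))"
  proof (rule card_edge_zeros_peel[where Q = "\<lambda>T. T \<subseteq> S" and m = 1])
    fix T assume T: "T \<subseteq> S" "1 < card T"
    have "\<exists>b e. pendant T b e"
    proof (rule acyclic_imp_pendant[of V])
      show "\<not> is_cycle T c" for c using S(1) is_cycle_mono[OF _ T(1)] by blast
    qed (use V T in auto)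
    then show "\<exists>b e. pendant T b e \<and> T - {e} \<subseteq> S" using T by blast
  next
    fix T U assume T: "T \<subseteq> S" "card T = 1" "finite U" "\<Union>T \<subseteq> U"
    then obtain e where e: "T = {e}" by (auto simp: card_1_singleton_iff)
    have "finite e" using T e by (auto intro: finite_subset)
    have "edge_form a T P \<noteq> 0" if "P \<in> U \<rightarrow>\<^sub>E (UNIV - {0})" for P
    proof -
      have "P i \<noteq> 0" if "i \<in> e" for i
        using \<open>P \<in> _\<close> that T(4) unfolding e by (auto simp: PiE_iff)
      then show ?thesis using a T(1) \<open>finite e\<close> by (simp add: edge_form_def e)
    qed
    then have "edge_zeros a U T = {}" by (auto simp: edge_zeros_def)
    then show "int (card (edge_zeros a U T)) = (int CARD('a) - 1) ^ (card U - 1) * 0" by simp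
  qed (use a V S \<open>finite S\<close> in \<open>auto simp: Suc_le_eq card_gt_0_iff\<close>)
  then show ?thesis by simp
qed

lemma card_edge_zeros_unicyclic:
  fixes a :: "'v set \<Rightarrow> 'a::{finite,field}"
  assumes V: "finite V" "\<Union>S \<subseteq> V" "\<And>e. e \<in> S \<Longrightarrow> card e = 2"
    and a: "\<And>e. e \<in> S \<Longrightarrow> a e \<noteq> 0"
    and c0: "is_induced_cycle S c0"
    and unique: "\<And>c. is_cycle S c \<Longrightarrow> set c \<subseteq> set c0"
  shows "int (card (edge_zeros a V S))
    = (-1) ^ (card S - length c0) * (int CARD('a) - 1) ^ (card V - card S)
        * int (card (edge_zeros a (set c0) (closed_walk_edges c0)))
      + (\<Sum>i = 1..card S - length c0. (-1) ^ (i + 1) * (int CARD('a) - 1) ^ (card V - i))"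
proof -
  let ?C = "closed_walk_edges c0"
  have cyc: "is_cycle S c0" using c0 by (simp add: is_induced_cycle_def)
  have "finite S" using V by (meson finite_Pow_iff finite_subset subset_Pow_Union)
  have sub: "?C \<subseteq> S" using cyc by (simp add: is_cycle_def)
  have card_C: "card ?C = length c0" using cyc by (rule card_closed_walk_edges)
  have card_set: "card (set c0) = length c0" using cyc by (simp add: is_cycle_def distinct_card)
  show ?thesis
  proof (rule card_edge_zeros_peel[where Q = "\<lambda>T. ?C \<subseteq> T \<and> T \<subseteq> S"])
    fix T assume T: "?C \<subseteq> T \<and> T \<subseteq> S" "length c0 < card T"
    have "is_induced_cycle T c0"
      using c0 T(1) by (auto simp: is_induced_cycle_def is_cycle_def)
    moreover have "set c \<subseteq> set c0" if "is_cycle T c" for c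
      using unique is_cycle_mono that T(1) by blast
    moreover have "\<Union>T \<subseteq> V" using V(2) T(1) by blast
    ultimately have "\<exists>b e. pendant T b e \<and> b \<notin> set c0"
      using V(1,3) T card_C by (intro beyond_cycle_imp_pendant[of V]) auto
    then obtain b e where b: "pendant T b e" "b \<notin> set c0" by blast
    then have "e \<notin> ?C" using Union_closed_walk_edges[of c0] by (auto simp: pendant_def)
    with b T(1) show "\<exists>b e. pendant T b e \<and> ?C \<subseteq> T - {e} \<and> T - {e} \<subseteq> S" by blast
  next
    fix T U assume T: "?C \<subseteq> T \<and> T \<subseteq> S" "card T = length c0" "finite U" "\<Union>T \<subseteq> U"
    then have "T = ?C"
      using card_C card_subset_eq[of T ?C] finite_subset[OF _ \<open>finite S\<close>] by auto
    then show "int (card (edge_zeros a U T))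
        = (int CARD('a) - 1) ^ (card U - length c0) * int (card (edge_zeros a (set c0) ?C))"
      using card_edge_zeros_free_vertices[of U "set c0" ?C a] T(3,4)
      by (simp add: Union_closed_walk_edges card_set)
  qed (use a V sub \<open>finite S\<close> card_C card_mono[of S ?C] in auto)
qed


section \<open>Zeros of the form of an even cycle\<close>

text \<open>
  Edges of a path or cycle on \<open>{1..m}\<close> are indexed by their smaller end; the closing edge of a cycle
  has a separate coefficient because it changes along the recursion.
\<close>

definition path_form :: "(nat \<Rightarrow> 'a::comm_ring_1) \<Rightarrow> nat \<Rightarrow> (nat \<Rightarrow> 'a) \<Rightarrow> 'a" where
  "path_form a m P = (\<Sum>i = 1..<m. a i * P i * P (Suc i))"

definition cycle_zeros :: "nat \<Rightarrow> (nat \<Rightarrow> 'a::comm_ring_1) \<Rightarrow> 'a \<Rightarrow> (nat \<Rightarrow> 'a) set" where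
  "cycle_zeros n a c = {P \<in> {1..n} \<rightarrow>\<^sub>E (UNIV - {0}). path_form a n P + c * P 1 * P n = 0}"

lemma path_form_Suc:
  "1 \<le> m \<Longrightarrow> path_form a (Suc m) P = path_form a m P + a m * P m * P (Suc m)"
  by (simp add: path_form_def)

lemma path_form_fun_upd: "m < b \<Longrightarrow> path_form a m (P(b := y)) = path_form a m P"
  unfolding path_form_def by (intro sum.cong) auto

text \<open>
  The last vertex of a path is pendant. The summand for \<open>m = 0\<close> accounts for the path without edges,
  whose form is zero.
\<close>

lemma card_path_zeros:
  fixes a :: "nat \<Rightarrow> 'a::{finite,field}"
  assumes "\<And>i. 1 \<le> i \<Longrightarrow> i \<le> m \<Longrightarrow> a i \<noteq> 0"
  shows "int (card {P \<in> {1..Suc m} \<rightarrow>\<^sub>E (UNIV - {0}). path_form a (Suc m) P = 0})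
    = (\<Sum>i = 1..m - 1. (-1) ^ (i + 1) * (int CARD('a) - 1) ^ (Suc m - i))
      + (if m = 0 then int CARD('a) - 1 else 0)"
  using assms
proof (induction m)
  case 0
  have "int (card ({1..Suc 0} \<rightarrow>\<^sub>E (UNIV - {0 :: 'a}))) = int CARD('a) - 1"
    by (subst card_torus) auto
  then show ?case by (simp add: path_form_def)
next
  case (Suc m)
  let ?X = "{1..Suc m} \<rightarrow>\<^sub>E (UNIV - {0 :: 'a})"
  have eq: "path_form a (Suc (Suc m)) (Q(Suc (Suc m) := y)) = 0
      \<longleftrightarrow> a (Suc m) * Q (Suc m) * y + path_form a (Suc m) Q = 0" for Q y
    using path_form_fun_upd[of "Suc m" "Suc (Suc m)" a Q y]
    by (simp add: path_form_Suc add.commute del: fun_upd_apply add: fun_upd_same fun_upd_other)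
  have nz: "{Q \<in> ?X. a (Suc m) * Q (Suc m) = 0} = {}"
    "{Q \<in> ?X. a (Suc m) * Q (Suc m) = 0 \<and> path_form a (Suc m) Q = 0} = {}"
    using Suc.prems[of "Suc m"] by (auto simp: PiE_iff)
  have "{1..Suc (Suc m)} = insert (Suc (Suc m)) {1..Suc m}" by auto
  then have "int (card {P \<in> {1..Suc (Suc m)} \<rightarrow>\<^sub>E (UNIV - {0}). path_form a (Suc (Suc m)) P = 0})
      = (int CARD('a) - 1) ^ Suc m - int (card {Q \<in> ?X. path_form a (Suc m) Q = 0})"
    by (simp only:)
       (subst card_affine_extension[where L = "\<lambda>Q. a (Suc m) * Q (Suc m)" and g = "path_form a (Suc m)"],
         simp, simp, rule eq, simp only: nz, simp)
  also have "int (card {Q \<in> ?X. path_form a (Suc m) Q = 0})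
    = (\<Sum>i = 1..m - 1. (-1) ^ (i + 1) * (int CARD('a) - 1) ^ (Suc m - i))
      + (if m = 0 then int CARD('a) - 1 else 0)"
    using Suc by simp
  finally have count: "int (card {P \<in> {1..Suc (Suc m)} \<rightarrow>\<^sub>E (UNIV - {0}). path_form a (Suc (Suc m)) P = 0})
      = (int CARD('a) - 1) ^ Suc m
        - ((\<Sum>i = 1..m - 1. (-1) ^ (i + 1) * (int CARD('a) - 1) ^ (Suc m - i))
           + (if m = 0 then int CARD('a) - 1 else 0))" .
  show ?case
  proof (cases m)
    case 0
    then show ?thesis using count by simp
  next
    case (Suc j)
    then show ?thesis
      unfolding count using alternating_power_sum_Suc[of "int CARD('a) - 1" "Suc (Suc m)" j]
      by (simp del: sum.cl_ivl_Suc)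
  qed
qed

text \<open>
  The form is affine in the last coordinate. Its slope \<open>a\<^sub>m\<^sub>+\<^sub>1 t\<^sub>m\<^sub>+\<^sub>1 + c t\<^sub>1\<close> vanishes if and only if
  \<open>t\<^sub>m\<^sub>+\<^sub>1 = - (c / a\<^sub>m\<^sub>+\<^sub>1) t\<^sub>1\<close>, and then the constant term, a path form, becomes the form of a cycle
  on \<open>m\<close> vertices. For \<open>m = 2\<close> that cycle is degenerate: two parallel edges.
\<close>

lemma card_cycle_zeros_step:
  fixes a :: "nat \<Rightarrow> 'a::{finite,field}"
  assumes a: "\<And>i. 1 \<le> i \<Longrightarrow> i \<le> Suc m \<Longrightarrow> a i \<noteq> 0" and c: "c \<noteq> 0" and m: "1 < m"
  shows "int (card (cycle_zeros (Suc (Suc m)) a c))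
    = int CARD('a) * int (card (cycle_zeros m a (- c * a m / a (Suc m)))) + d_num (int CARD('a)) (Suc (Suc m))"
proof -
  let ?q = "int CARD('a)" and ?n = "Suc (Suc m)"
  let ?X = "\<lambda>m. {1..m} \<rightarrow>\<^sub>E (UNIV - {0 :: 'a})"
  let ?L = "\<lambda>P. a (Suc m) * P (Suc m) + c * P 1" and ?g = "path_form a (Suc m)"
  have ins: "{1..Suc j} = insert (Suc j) {1..j}" for j :: nat by auto
  have "path_form a ?n (Q(?n := y)) + c * (Q(?n := y)) 1 * (Q(?n := y)) ?n = 0 \<longleftrightarrow> ?L Q * y + ?g Q = 0" for Q y
    using path_form_fun_upd[of "Suc m" ?n a Q y] by (simp add: path_form_Suc algebra_simps)
  then have "int (card (cycle_zeros ?n a c)) = (?q - 1) ^ Suc m - int (card {Q \<in> ?X (Suc m). ?L Q = 0})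
      - int (card {Q \<in> ?X (Suc m). ?g Q = 0}) + ?q * int (card {Q \<in> ?X (Suc m). ?L Q = 0 \<and> ?g Q = 0})"
    unfolding cycle_zeros_def ins[of "Suc m"]
    by (subst card_affine_extension[where L = ?L and g = ?g]) simp_all
  moreover have root: "?L (Q(Suc m := y)) = 0 \<longleftrightarrow> y = - c / a (Suc m) * Q 1" for Q y
    using a[of "Suc m"] m by (auto simp: field_simps eq_neg_iff_add_eq_0)
  have nz: "- c / a (Suc m) * Q 1 \<noteq> 0" if "Q \<in> ?X m" for Q
    using that a[of "Suc m"] c m by (auto simp: PiE_iff)
  have "card {Q \<in> ?X (Suc m). ?L Q = 0} = card {Q \<in> ?X m. True}"
    unfolding ins[of m] by (rule PiE_Collect_linear_root[OF _ _ nz]) (simp_all only: root, auto)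
  then have "int (card {Q \<in> ?X (Suc m). ?L Q = 0}) = (?q - 1) ^ m"
    by (simp add: card_torus)
  moreover have "card {Q \<in> ?X (Suc m). ?L Q = 0 \<and> ?g Q = 0} = card (cycle_zeros m a (- c * a m / a (Suc m)))"
    unfolding cycle_zeros_def ins[of m]
  proof (rule PiE_Collect_linear_root[OF _ _ nz])
    fix Q :: "nat \<Rightarrow> 'a" and y
    have "?g (Q(Suc m := y)) = path_form a m Q + a m * Q m * y"
      using path_form_fun_upd[of m "Suc m" a Q y] m by (simp add: path_form_Suc)
    then show "(?L (Q(Suc m := y)) = 0 \<and> ?g (Q(Suc m := y)) = 0) \<longleftrightarrow>
        y = - c / a (Suc m) * Q 1 \<and> path_form a m Q + - c * a m / a (Suc m) * Q 1 * Q m = 0"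
      unfolding root by (auto simp: mult_ac)
  qed auto
  moreover have "int (card {Q \<in> ?X (Suc m). ?g Q = 0})
      = (\<Sum>i = 1..m - 1. (-1) ^ (i + 1) * (?q - 1) ^ (Suc m - i))"
    using card_path_zeros[of m a] a m by simp
  moreover have "d_num ?q ?n = (?q - 1) ^ Suc m
      - (\<Sum>i = 1..m - 1. (-1) ^ (i + 1) * (?q - 1) ^ (Suc m - i)) - (?q - 1) ^ m"
    using alternating_power_sum_Suc[of "?q - 1" ?n "m - 1"] m by (simp add: d_num_def del: sum.cl_ivl_Suc)
  ultimately show ?thesis by (simp only:)
qed

text \<open>
  Starting the induction at the degenerate cycle with \<open>k = 1\<close> avoids a separate count for the
  quadrangle. The replacement of \<open>c\<close> by \<open>- c a\<^sub>2\<^sub>k / a\<^sub>2\<^sub>k\<^sub>+\<^sub>1\<close> divides the alternating product by the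
  unit \<open>a\<^sub>2\<^sub>k\<^sub>+\<^sub>1\<close>, so the case distinction is the same at every stage.
\<close>

lemma card_even_cycle_zeros:
  fixes a :: "nat \<Rightarrow> 'a::{finite,field}"
  assumes "1 \<le> k" "\<And>i. 1 \<le> i \<Longrightarrow> i < 2 * k \<Longrightarrow> a i \<noteq> 0" "c \<noteq> 0"
  shows "int (card (cycle_zeros (2 * k) a c))
    = int CARD('a) ^ (k - 1) *
        (if (\<Prod>j<k. a (2 * j + 1)) + (-1) ^ (k - 1) * c * (\<Prod>j<k - 1. a (2 * j + 2)) = 0
         then (int CARD('a) - 1)\<^sup>2 else 0)
      + (\<Sum>i<k - 1. int CARD('a) ^ i * d_num (int CARD('a)) (2 * k - 2 * i))"
  using assms
proof (induction k arbitrary: c rule: nat_induct_at_least)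
  case base
  have eq: "path_form a 2 P + c * P 1 * P 2 = (a 1 + c) * (P 1 * P 2)" for P
    by (simp add: path_form_def numeral_2_eq_2 algebra_simps)
  have "cycle_zeros 2 a c = (if a 1 + c = 0 then {1..2} \<rightarrow>\<^sub>E (UNIV - {0}) else {})"
    unfolding cycle_zeros_def eq by (auto simp: PiE_iff extensional_def)
  then show ?case by (simp add: card_torus)
next
  case (Suc k)
  let ?q = "int CARD('a)"
  define c' where "c' = - c * a (2 * k) / a (Suc (2 * k))"
  have nz: "a (2 * k) \<noteq> 0" "a (Suc (2 * k)) \<noteq> 0" using Suc.prems(1) Suc.hyps by auto
  have "c' \<noteq> 0" using nz Suc.prems(2) by (simp add: c'_def)
  obtain j where k: "k = Suc j" using Suc.hyps by (cases k) auto
  let ?odd = "\<Prod>j<k. a (2 * j + 1)" and ?even = "\<Prod>j<k - 1. a (2 * j + 2)"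
  have "?odd * a (Suc (2 * k)) + (-1) ^ k * c * (?even * a (2 * k))
      = a (Suc (2 * k)) * (?odd + (-1) ^ (k - 1) * c' * ?even)"
    using nz by (simp add: k c'_def field_simps)
  then have cond: "(\<Prod>j<Suc k. a (2 * j + 1)) + (-1) ^ (Suc k - 1) * c * (\<Prod>j<Suc k - 1. a (2 * j + 2)) = 0
      \<longleftrightarrow> ?odd + (-1) ^ (k - 1) * c' * ?even = 0"
    using nz by (simp add: k)
  have "int (card (cycle_zeros (2 * Suc k) a c)) = ?q * int (card (cycle_zeros (2 * k) a c')) + d_num ?q (2 * Suc k)"
    using card_cycle_zeros_step[of "2 * k" a c] Suc.prems Suc.hyps by (simp add: c'_def)
  also have "int (card (cycle_zeros (2 * k) a c'))
      = ?q ^ (k - 1) * (if ?odd + (-1) ^ (k - 1) * c' * ?even = 0 then (?q - 1)\<^sup>2 else 0)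
        + (\<Sum>i<k - 1. ?q ^ i * d_num ?q (2 * k - 2 * i))"
    using Suc.prems(1) \<open>c' \<noteq> 0\<close> by (intro Suc.IH) auto
  also have "?q * \<dots> + d_num ?q (2 * Suc k)
      = ?q ^ (Suc k - 1) * (if ?odd + (-1) ^ (k - 1) * c' * ?even = 0 then (?q - 1)\<^sup>2 else 0)
        + (\<Sum>i<Suc k - 1. ?q ^ i * d_num ?q (2 * Suc k - 2 * i))"
    unfolding k by (simp add: sum.lessThan_Suc_shift sum_distrib_left algebra_simps del: sum.lessThan_Suc)
  finally show ?case unfolding cond .
qed

lemma prod_odd_reindex:
  fixes k :: nat
  shows "(\<Prod>i\<in>{i. 1 \<le> i \<and> i \<le> 2 * k - 1 \<and> odd i}. g i) = (\<Prod>j<k. g (2 * j + 1))"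
  by (rule prod.reindex_bij_witness[of _ "\<lambda>j. 2 * j + 1" "\<lambda>i. i div 2"]) (auto elim!: oddE)

lemma prod_even_reindex:
  fixes k :: nat
  shows "(\<Prod>i\<in>{i. 1 \<le> i \<and> i \<le> 2 * k - 2 \<and> even i}. g i) = (\<Prod>j<k - 1. g (2 * j + 2))"
proof -
  have "{i. 1 \<le> i \<and> i \<le> 2 * k - 2 \<and> even i} = (\<lambda>j. 2 * j + 2) ` {..<k - 1}"
  proof (intro set_eqI iffI)
    fix i assume i: "i \<in> {i. 1 \<le> i \<and> i \<le> 2 * k - 2 \<and> even i}"
    then obtain b where "i = 2 * b" by (auto elim: evenE)
    with i have "i = 2 * (b - 1) + 2" "b - 1 < k - 1" by auto
    then show "i \<in> (\<lambda>j. 2 * j + 2) ` {..<k - 1}" by blast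
  qed auto
  then show ?thesis by (simp add: prod.reindex inj_on_def)
qed


section \<open>Polynomials supported on edges\<close>

lemma eval_mpoly_superset:
  assumes "finite M" "Poly_Mapping.keys f \<subseteq> M"
  shows "eval_mpoly P f = (\<Sum>m\<in>M. Poly_Mapping.lookup f m *
    (\<Prod>i\<in>Poly_Mapping.keys m. P i ^ Poly_Mapping.lookup m i))"
  unfolding eval_mpoly_def
  by (rule sum.mono_neutral_left) (use assms in \<open>auto simp: in_keys_iff\<close>)

lemma eval_mpoly_zero: "eval_mpoly P 0 = 0"
  by (simp add: eval_mpoly_def)

lemma eval_mpoly_add: "eval_mpoly P (f + g) = eval_mpoly P f + eval_mpoly P g"
proof -
  let ?M = "Poly_Mapping.keys f \<union> Poly_Mapping.keys g"
  have "Poly_Mapping.keys (f + g) \<subseteq> ?M" by (rule keys_add)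
  then show ?thesis
    by (simp add: eval_mpoly_superset[of ?M] lookup_add distrib_right sum.distrib)
qed

lemma eval_mpoly_sum: "eval_mpoly P (\<Sum>i\<in>I. f i) = (\<Sum>i\<in>I. eval_mpoly P (f i))"
  by (induction I rule: infinite_finite_induct) (auto simp: eval_mpoly_zero eval_mpoly_add)

text \<open>
  Indexing squarefree monomials by sets turns coefficients of an edge polynomial into weights on
  edges.
\<close>

definition edge_monom :: "nat set \<Rightarrow> nat \<Rightarrow>\<^sub>0 nat" where
  "edge_monom e = (\<Sum>i\<in>e. Poly_Mapping.single i 1)"

lemma lookup_edge_monom:
  "finite e \<Longrightarrow> Poly_Mapping.lookup (edge_monom e) i = of_bool (i \<in> e)"
  unfolding edge_monom_def
  by (simp add: lookup_sum lookup_single when_def of_bool_def)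

lemma keys_edge_monom: "finite e \<Longrightarrow> Poly_Mapping.keys (edge_monom e) = e"
  by (auto simp: in_keys_iff lookup_edge_monom)

lemma edge_monom_insert:
  "i \<noteq> j \<Longrightarrow> edge_monom {i, j} = Poly_Mapping.single i 1 + Poly_Mapping.single j 1"
  by (simp add: edge_monom_def)

lemma inj_on_edge_monom: "(\<And>e. e \<in> E \<Longrightarrow> finite e) \<Longrightarrow> inj_on edge_monom E"
  by (rule inj_onI) (metis keys_edge_monom)

lemma edge_monom_value:
  "finite e \<Longrightarrow> (\<Prod>i\<in>Poly_Mapping.keys (edge_monom e). P i ^ Poly_Mapping.lookup (edge_monom e) i)
    = (\<Prod>i\<in>e. P i)"
  by (simp add: keys_edge_monom lookup_edge_monom cong: prod.cong)

lemma Const_Var_Var: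
  "i \<noteq> j \<Longrightarrow> Const c * Var i * Var j = Poly_Mapping.single (edge_monom {i, j}) (c :: 'a::field)"
  by (simp add: Const_def Var_def mult_single edge_monom_insert)

lemma eval_mpoly_Const_Var_Var:
  fixes c :: "'a::field"
  assumes "i \<noteq> j"
  shows "eval_mpoly P (Const c * Var i * Var j) = c * P i * P j"
proof -
  let ?m = "edge_monom {i, j}"
  have "eval_mpoly P (Const c * Var i * Var j)
      = c * (\<Prod>i\<in>Poly_Mapping.keys ?m. P i ^ Poly_Mapping.lookup ?m i)"
    unfolding Const_Var_Var[OF assms]
    by (subst eval_mpoly_superset[of "{?m}"]) auto
  with assms show ?thesis by (simp add: edge_monom_value)
qed

lemma keys_KE:
  assumes E: "\<And>e. e \<in> E \<Longrightarrow> card e = 2" and f: "f \<in> KE E"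
  shows "Poly_Mapping.keys f \<subseteq> edge_monom ` E"
proof -
  let ?S = "{f. \<forall>m. m \<notin> edge_monom ` E \<longrightarrow> Poly_Mapping.lookup f m = 0}"
  have "f \<in> ?S"
    using f unfolding KE_def
  proof (rule mpoly.span_induct_alt[where h = "\<lambda>f. f \<in> ?S"])
    fix c :: 'a and x y :: "'a mpoly"
    assume "x \<in> {Var i * Var j | i j. {i, j} \<in> E}" and y: "y \<in> ?S"
    then obtain i j where x: "x = Var i * Var j" "{i, j} \<in> E" by blast
    have "i \<noteq> j" using E[OF x(2)] by auto
    then have "mpoly_scale c x = Poly_Mapping.single (edge_monom {i, j}) c"
      by (simp add: mpoly_scale_def x Const_Var_Var mult.assoc[symmetric])
    then show "mpoly_scale c x + y \<in> ?S" using y x(2) by (auto simp: lookup_add lookup_single when_def)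
  qed simp
  then show ?thesis by (auto simp: in_keys_iff)
qed

lemma eval_mpoly_KE:
  assumes "finite E" "\<And>e. e \<in> E \<Longrightarrow> card e = 2" "Poly_Mapping.keys f \<subseteq> edge_monom ` E"
  shows "eval_mpoly P f = edge_form (\<lambda>e. Poly_Mapping.lookup f (edge_monom e))
    {e \<in> E. Poly_Mapping.lookup f (edge_monom e) \<noteq> 0} P"
proof -
  have fin: "finite e" if "e \<in> E" for e
    using assms(2)[OF that] by (simp add: card_ge_0_finite)
  have "eval_mpoly P f = (\<Sum>m\<in>edge_monom ` E. Poly_Mapping.lookup f m *
      (\<Prod>i\<in>Poly_Mapping.keys m. P i ^ Poly_Mapping.lookup m i))"
    using assms by (intro eval_mpoly_superset) auto
  also have "\<dots> = (\<Sum>e\<in>E. Poly_Mapping.lookup f (edge_monom e) * (\<Prod>i\<in>e. P i))"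
    using fin by (simp add: sum.reindex inj_on_edge_monom edge_monom_value cong: sum.cong)
  also have "\<dots> = (\<Sum>e | e \<in> E \<and> Poly_Mapping.lookup f (edge_monom e) \<noteq> 0.
      Poly_Mapping.lookup f (edge_monom e) * (\<Prod>i\<in>e. P i))"
    by (rule sum.mono_neutral_right) (use assms(1) in auto)
  finally show ?thesis by (simp add: edge_form_def)
qed

lemma num_terms_eq_card:
  assumes "\<And>e. e \<in> E \<Longrightarrow> card e = 2"
  shows "num_terms E f = card {e \<in> E. Poly_Mapping.lookup f (edge_monom e) \<noteq> 0}"
proof -
  have "{m. (\<exists>i j. {i, j} \<in> E \<and> m = Poly_Mapping.single i 1 + Poly_Mapping.single j 1) \<and>
      Poly_Mapping.lookup f m \<noteq> 0} = edge_monom ` {e \<in> E. Poly_Mapping.lookup f (edge_monom e) \<noteq> 0}"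
    (is "?L = ?R")
  proof
    show "?L \<subseteq> ?R"
    proof
      fix m assume "m \<in> ?L"
      then obtain i j where ij: "{i, j} \<in> E" "m = Poly_Mapping.single i 1 + Poly_Mapping.single j 1"
        "Poly_Mapping.lookup f m \<noteq> 0" by blast
      have "i \<noteq> j" using assms[OF ij(1)] by auto
      then have "m = edge_monom {i, j}" using ij(2) by (simp add: edge_monom_insert)
      then show "m \<in> ?R" using ij by blast
    qed
    show "?R \<subseteq> ?L"
    proof
      fix m assume "m \<in> ?R"
      then obtain e where e: "e \<in> E" "m = edge_monom e" "Poly_Mapping.lookup f m \<noteq> 0" by blast
      obtain i j where "e = {i, j}" "i \<noteq> j" using assms[OF e(1)] by (auto simp: card_2_iff)
      then show "m \<in> ?L" using e edge_monom_insert[of i j] by blast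
    qed
  qed
  moreover have "inj_on edge_monom {e \<in> E. Poly_Mapping.lookup f (edge_monom e) \<noteq> 0}"
    using assms by (intro inj_on_edge_monom) (force intro: card_ge_0_finite)
  ultimately show ?thesis unfolding num_terms_def by (simp add: card_image)
qed

lemma lookup_Const_Var_Var:
  fixes c :: "'a::field"
  assumes "i \<noteq> j" "finite e"
  shows "Poly_Mapping.lookup (Const c * Var i * Var j) (edge_monom e) = (if e = {i, j} then c else 0)"
proof -
  have "edge_monom {i, j} = edge_monom e \<longleftrightarrow> e = {i, j}"
    using assms(2) keys_edge_monom[of e] keys_edge_monom[of "{i, j}"] by auto
  then show ?thesis using assms(1) by (simp add: Const_Var_Var lookup_single when_def)
qed

definition cycle_poly :: "nat \<Rightarrow> (nat \<Rightarrow> nat \<Rightarrow> 'a::field) \<Rightarrow> 'a mpoly" where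
  "cycle_poly n \<alpha> = (\<Sum>i = 1..n - 1. Const (\<alpha> i (i + 1)) * Var i * Var (i + 1))
                  + Const (\<alpha> 1 n) * Var 1 * Var n"

text \<open>
  For \<open>n \<ge> 3\<close> the closing edge is none of the other ones, so no coefficients are added up.
\<close>

lemma lookup_cycle_poly:
  fixes \<alpha> :: "nat \<Rightarrow> nat \<Rightarrow> 'a::field"
  assumes "3 \<le> n"
  shows "i \<in> {1..n - 1} \<Longrightarrow> Poly_Mapping.lookup (cycle_poly n \<alpha>) (edge_monom {i, i + 1}) = \<alpha> i (i + 1)"
    and "Poly_Mapping.lookup (cycle_poly n \<alpha>) (edge_monom {1, n}) = \<alpha> 1 n"
proof -
  have lookup: "Poly_Mapping.lookup (cycle_poly n \<alpha>) (edge_monom e)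
      = (\<Sum>i = 1..n - 1. if e = {i, i + 1} then \<alpha> i (i + 1) else 0) + (if e = {1, n} then \<alpha> 1 n else 0)"
    if "finite e" for e
    using assms that by (simp add: cycle_poly_def lookup_add lookup_sum lookup_Const_Var_Var cong: if_cong)
  have ne: "{1, n} \<noteq> {i, i + 1}" for i
    using assms by (auto simp: doubleton_eq_iff)
  have eq: "{i, i + 1} = {j, j + 1} \<longleftrightarrow> i = j" for i j :: nat
    by (auto simp: doubleton_eq_iff)
  show "Poly_Mapping.lookup (cycle_poly n \<alpha>) (edge_monom {1, n}) = \<alpha> 1 n"
    by (subst lookup) (simp_all add: ne[simplified])
  show "Poly_Mapping.lookup (cycle_poly n \<alpha>) (edge_monom {i, i + 1}) = \<alpha> i (i + 1)" if "i \<in> {1..n - 1}"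
    using that ne[of i, symmetric] by (subst lookup) (simp_all only: eq, simp_all)
qed

lemma cycle_poly_in_KE: "cycle_poly n \<alpha> \<in> KE (std_cycle n)"
proof -
  have "Const c * Var i * Var j \<in> KE (std_cycle n)" if "{i, j} \<in> std_cycle n" for c :: 'a and i j
  proof -
    have "mpoly_scale c (Var i * Var j) \<in> KE (std_cycle n)"
      unfolding KE_def by (intro mpoly.span_scale mpoly.span_base) (use that in blast)
    then show ?thesis by (simp add: mpoly_scale_def mult.assoc)
  qed
  then show ?thesis
    unfolding cycle_poly_def KE_def
    by (intro mpoly.span_add mpoly.span_sum) (auto simp: std_cycle_def)
qed

lemma torus_zeros_cycle_poly:
  assumes "2 \<le> n"
  shows "torus_zeros n (cycle_poly n \<alpha>) = cycle_zeros n (\<lambda>i. \<alpha> i (i + 1)) (\<alpha> 1 n)"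
proof -
  have "{1..n - 1} = {1..<n}" using assms by auto
  then have "eval_mpoly P (cycle_poly n \<alpha>) = path_form (\<lambda>i. \<alpha> i (i + 1)) n P + \<alpha> 1 n * P 1 * P n" for P
    using assms
    by (simp add: cycle_poly_def eval_mpoly_add eval_mpoly_sum eval_mpoly_Const_Var_Var path_form_def)
  then show ?thesis by (simp add: torus_zeros_def cycle_zeros_def torus_def)
qed


section \<open>Zeros of polynomials on unicyclic graphs\<close>

theorem theorem5p2:
  fixes E :: "nat set set"
    and s n k r q :: nat
    and \<alpha> :: "nat \<Rightarrow> nat \<Rightarrow> 'a::{finite, field}"
    and f fn f' :: "'a mpoly"
  assumes q: "q = card (UNIV :: 'a set)" "q > 2"
    and graph: "simple_graph {1..s} E" "connected_graph {1..s} E" "unicyclic E"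
    and length: "n = 2 * k" "n \<ge> 4" "\<And>c. is_induced_cycle E c \<Longrightarrow> length c = n"
    and cycle: "{1..n} \<subseteq> {1..s}" "{e \<in> E. e \<subseteq> {1..n}} = std_cycle n"
    and f: "f \<in> KE E" "f \<noteq> 0" "f = fn + f'"
    and fn: "fn = (\<Sum>i = 1..n - 1. Const (\<alpha> i (i + 1)) * Var i * Var (i + 1))
                  + Const (\<alpha> 1 n) * Var 1 * Var n"
    and f': "f' \<in> KE (E - std_cycle n)"
    and r: "num_terms E f = r"
  shows "((\<exists>i\<in>{1..n - 1}. \<alpha> i (i + 1) = 0) \<or> \<alpha> 1 n = 0 \<longrightarrow>
           int (card (torus_zeros s f)) =
             (\<Sum>i = 1..r - 1. (-1) ^ (i + 1) * (int q - 1) ^ (s - i)))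
       \<and> ((\<forall>i\<in>{1..n - 1}. \<alpha> i (i + 1) \<noteq> 0) \<and> \<alpha> 1 n \<noteq> 0 \<longrightarrow>
           int (card (torus_zeros s f)) =
             (-1) ^ (r - n) * (int q - 1) ^ (s - r) * int (card (torus_zeros n fn))
             + (\<Sum>i = 1..r - n. (-1) ^ (i + 1) * (int q - 1) ^ (s - i))
         \<and> int (card (torus_zeros n fn)) =
             (if (\<Prod>i\<in>{i. 1 \<le> i \<and> i \<le> 2 * k - 1 \<and> odd i}. \<alpha> i (i + 1))
                 + (-1) ^ (k - 1) * \<alpha> 1 n *
                   (\<Prod>i\<in>{i. 1 \<le> i \<and> i \<le> 2 * k - 2 \<and> even i}. \<alpha> i (i + 1)) = 0
              then int q ^ (k - 2) * ((int q - 1) ^ 3 + (int q - 1) ^ 2 * (int q - 2))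
                   + (\<Sum>i < k - 2. int q ^ i * d_num (int q) (n - 2 * i))
              else int q ^ (k - 2) * (int q - 1) ^ 2 * (int q - 3)
                   + (\<Sum>i < k - 2. int q ^ i * d_num (int q) (n - 2 * i))))"
proof -
  define a where "a e = Poly_Mapping.lookup f (edge_monom e)" for e
  define S where "S = {e \<in> E. a e \<noteq> 0}"
  let ?C = "std_cycle n" and ?c0 = "[1..<Suc n]"

  have E2: "card e = 2" "finite e" if "e \<in> E" for e
    using graph(1) that by (auto simp: simple_graph_def intro: card_ge_0_finite)
  have "finite E" and E_V: "\<Union>E \<subseteq> {1..s}"
    using graph(1) finite_subset[of E "Pow {1..s}"] by (auto simp: simple_graph_def)
  have S: "S \<subseteq> E" "\<And>e. e \<in> S \<Longrightarrow> card e = 2" "\<Union>S \<subseteq> {1..s}" "\<And>e. e \<in> S \<Longrightarrow> a e \<noteq> 0"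
    using E2 E_V by (auto simp: S_def)
  have card_S: "card S = r"
    using num_terms_eq_card[of E f] E2 r by (simp add: S_def a_def)

  have c0: "closed_walk_edges ?c0 = ?C" "set ?c0 = {1..n}" "length ?c0 = n"
    using closed_walk_edges_upt[of n] length(2) by auto
  have C_E: "?C \<subseteq> E" using cycle(2) by blast
  have ind: "is_induced_cycle E ?c0"
    unfolding is_induced_cycle_def is_cycle_def c0 using cycle(2) length(2) by auto
  have unique: "closed_walk_edges c = ?C" if "is_cycle E c" for c
    using unicyclic_imp_unique_cycle[OF graph(3) E2(1) ind that] c0(1) by simp

  have fn': "fn = cycle_poly n \<alpha>" by (simp add: fn cycle_poly_def)
  have f'_C: "Poly_Mapping.lookup f' (edge_monom e) = 0" if "e \<in> ?C" for e
  proof -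
    have "Poly_Mapping.keys f' \<subseteq> edge_monom ` (E - ?C)"
      using E2 f' by (intro keys_KE) auto
    moreover have "edge_monom e \<notin> edge_monom ` (E - ?C)"
      using inj_on_edge_monom[of E] E2(2) C_E that by (auto dest!: inj_onD)
    ultimately show ?thesis by (auto simp: in_keys_iff)
  qed
  have a_C: "a e = Poly_Mapping.lookup fn (edge_monom e)" if "e \<in> ?C" for e
    using f'_C[OF that] by (simp add: a_def f(3) lookup_add)
  have a_step: "a {i, i + 1} = \<alpha> i (i + 1)" "{i, i + 1} \<in> ?C" if "i \<in> {1..n - 1}" for i
  proof -
    show "{i, i + 1} \<in> ?C" using that unfolding std_cycle_def by blast
    then show "a {i, i + 1} = \<alpha> i (i + 1)"
      using lookup_cycle_poly(1)[of n i \<alpha>] length(2) that a_C[of "{i, i + 1}"] by (simp add: fn')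
  qed
  have a_last: "a {1, n} = \<alpha> 1 n" "{1, n} \<in> ?C"
  proof -
    show "{1, n} \<in> ?C" unfolding std_cycle_def by blast
    then show "a {1, n} = \<alpha> 1 n"
      using lookup_cycle_poly(2)[of n \<alpha>] length(2) a_C[of "{1, n}"] by (simp add: fn')
  qed
  have C_S: "?C \<subseteq> S \<longleftrightarrow> (\<forall>i\<in>{1..n - 1}. \<alpha> i (i + 1) \<noteq> 0) \<and> \<alpha> 1 n \<noteq> 0"
  proof
    assume "?C \<subseteq> S"
    then have "a e \<noteq> 0" if "e \<in> ?C" for e using S(4) that by blast
    then show "(\<forall>i\<in>{1..n - 1}. \<alpha> i (i + 1) \<noteq> 0) \<and> \<alpha> 1 n \<noteq> 0"
      using a_step a_last by metis
  next
    assume nz: "(\<forall>i\<in>{1..n - 1}. \<alpha> i (i + 1) \<noteq> 0) \<and> \<alpha> 1 n \<noteq> 0"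
    show "?C \<subseteq> S"
    proof
      fix e assume e: "e \<in> ?C"
      then have "(\<exists>i\<in>{1..n - 1}. e = {i, i + 1}) \<or> e = {1, n}" unfolding std_cycle_def by blast
      then have "a e \<noteq> 0" using nz a_step(1) a_last(1) by metis
      then show "e \<in> S" using e C_E by (auto simp: S_def)
    qed
  qed

  have zeros_f: "torus_zeros s f = edge_zeros a {1..s} S"
  proof -
    have "eval_mpoly P f = edge_form a S P" for P
      using eval_mpoly_KE[OF \<open>finite E\<close> E2(1) keys_KE[OF E2(1) f(1)], of P]
      unfolding S_def by (simp add: a_def[abs_def])
    then show ?thesis by (simp add: torus_zeros_def edge_zeros_def torus_def)
  qed

  have part1: "int (card (torus_zeros s f)) = (\<Sum>i = 1..r - 1. (-1) ^ (i + 1) * (int q - 1) ^ (s - i))"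
    if "\<not> ?C \<subseteq> S"
  proof -
    have "\<not> is_cycle S c" for c
      using unique[OF is_cycle_mono[OF _ S(1)], of c] that by (auto simp: is_cycle_def)
    moreover have "S \<noteq> {}"
    proof -
      have "Poly_Mapping.keys f \<noteq> {}" using f(2) by simp
      then show ?thesis using keys_KE[OF E2(1) f(1)] by (fastforce simp: S_def a_def in_keys_iff)
    qed
    ultimately show ?thesis
      using card_edge_zeros_acyclic[of "{1..s}" S a] S by (simp add: zeros_f card_S q(1))
  qed

  have part2: "int (card (torus_zeros s f)) =
             (-1) ^ (r - n) * (int q - 1) ^ (s - r) * int (card (torus_zeros n fn))
             + (\<Sum>i = 1..r - n. (-1) ^ (i + 1) * (int q - 1) ^ (s - i))"
    if sub: "?C \<subseteq> S"
  proof -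
    have "eval_mpoly P fn = edge_form a ?C P" for P
    proof -
      have C2: "card e = 2" if "e \<in> ?C" for e using that C_E E2 by blast
      have "finite ?C" using C_E \<open>finite E\<close> by (rule finite_subset)
      then have "eval_mpoly P fn = edge_form (\<lambda>e. Poly_Mapping.lookup fn (edge_monom e))
          {e \<in> ?C. Poly_Mapping.lookup fn (edge_monom e) \<noteq> 0} P"
        using C2 cycle_poly_in_KE[of n \<alpha>] unfolding fn' by (intro eval_mpoly_KE keys_KE)
      also have "{e \<in> ?C. Poly_Mapping.lookup fn (edge_monom e) \<noteq> 0} = ?C"
      proof -
        have "Poly_Mapping.lookup fn (edge_monom e) \<noteq> 0" if "e \<in> ?C" for e
          using sub S(4)[of e] a_C[of e] that by auto
        then show ?thesis by blast
      qed
      also have "edge_form (\<lambda>e. Poly_Mapping.lookup fn (edge_monom e)) ?C P = edge_form a ?C P"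
        unfolding edge_form_def by (intro sum.cong) (simp_all add: a_C)
      finally show ?thesis .
    qed
    then have zeros_fn: "torus_zeros n fn = edge_zeros a {1..n} ?C"
      by (simp add: torus_zeros_def edge_zeros_def torus_def)
    have "is_induced_cycle S ?c0"
      using ind sub S(1) unfolding is_induced_cycle_def is_cycle_def c0 by blast
    moreover have "set c \<subseteq> set ?c0" if "is_cycle S c" for c
      using unique[OF is_cycle_mono[OF that S(1)]] c0(1) by (metis Union_closed_walk_edges order_refl)
    ultimately show ?thesis
      using card_edge_zeros_unicyclic[of "{1..s}" S a ?c0] S
      unfolding c0 by (simp add: zeros_f zeros_fn card_S q(1))
  qed

  have part3: "int (card (torus_zeros n fn)) =
             (if (\<Prod>i\<in>{i. 1 \<le> i \<and> i \<le> 2 * k - 1 \<and> odd i}. \<alpha> i (i + 1))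
                 + (-1) ^ (k - 1) * \<alpha> 1 n *
                   (\<Prod>i\<in>{i. 1 \<le> i \<and> i \<le> 2 * k - 2 \<and> even i}. \<alpha> i (i + 1)) = 0
              then int q ^ (k - 2) * ((int q - 1) ^ 3 + (int q - 1) ^ 2 * (int q - 2))
                   + (\<Sum>i < k - 2. int q ^ i * d_num (int q) (n - 2 * i))
              else int q ^ (k - 2) * (int q - 1) ^ 2 * (int q - 3)
                   + (\<Sum>i < k - 2. int q ^ i * d_num (int q) (n - 2 * i)))"
    if nz: "(\<forall>i\<in>{1..n - 1}. \<alpha> i (i + 1) \<noteq> 0) \<and> \<alpha> 1 n \<noteq> 0"
  proof -
    obtain j where k: "k = Suc (Suc j)"
      using length(1,2) by (metis add_2_eq_Suc le_Suc_ex mult_le_cancel1 numeral_Bit0 mult_2 zero_less_numeral)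
    \<comment> \<open>The recursion from the degenerate cycle has one more summand, \<open>d\<^sub>4\<close>; adding it to the two
      possible counts there gives the constants of the quadrangle.\<close>
    have d4: "d_num x 4 = (x - 1) ^ 3 - 2 * (x - 1) ^ 2" for x
      by (simp add: d_num_def numeral_eq_Suc)
    have count: "int (card (torus_zeros n fn)) = int q ^ (k - 1) *
        (if (\<Prod>j<k. \<alpha> (2 * j + 1) (2 * j + 1 + 1)) + (-1) ^ (k - 1) * \<alpha> 1 n * (\<Prod>j<k - 1. \<alpha> (2 * j + 2) (2 * j + 2 + 1)) = 0
         then (int q - 1)\<^sup>2 else 0)
      + (\<Sum>i<k - 1. int q ^ i * d_num (int q) (n - 2 * i))"
      unfolding fn' q(1) length(1)
      using card_even_cycle_zeros[of k "\<lambda>i. \<alpha> i (i + 1)" "\<alpha> 1 n"] nz length(1,2)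
      by (subst torus_zeros_cycle_poly) auto
    show ?thesis
      unfolding count prod_odd_reindex prod_even_reindex
      by (simp add: k length(1) d4 power2_eq_square power3_eq_cube algebra_simps)
  qed

  show ?thesis using part1 part2 part3 unfolding C_S by blast
qed

end
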